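(* Let $\Omega\subset\mathbb R^2$ and the weight $W$ on $\Omega$ be fully symmetric. For each of the four sign choices and each $m\ge0$, let $\{P_{j,m}(W_{\pm\frac12,\pm\frac12}):0\le j\le m\}$ be an orthonormal basis of $\mathcal V_m(W_{\pm\frac12,\pm\frac12},\sqrt\Omega)$. Define $$P_j^n(W;u,v)=\begin{cases}P_{j,m}(W_{-\frac12,-\frac12};u^2,v^2),\ 0\le j\le m,& n=2m,\\ v\,P_{j,m}(W_{-\frac12,\frac12};u^2,v^2),\ 0\le j\le m,& n=2m+1.\end{cases}$$ Then $\{P_j^n(W):0\le j\le\lfloor n/2\rfloor\}$ is an orthonormal basis of $\mathcal V_n^E(W,\Omega)$. Furthermore, define $$Q_j^n(W;u,v)=\begin{cases}uv\,P_{j,m-1}(W_{\frac12,\frac12};u^2,v^2),\ 0\le j\le m-1,& n=2m,\\ u\,P_{j,m}(W_{\frac12,-\frac12};u^2,v^2),\ 0\le j\le m,& n=2m+1.\end{cases}$$ Then $\{Q_j^n(W)\}$ (with $0\le j\le m-1$ if $n=2m$ and $0\le j\le m$ if $n=2m+1$) is an orthonormal basis of $\mathcal V_n^O(W,\Omega)$.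
   Context: A domain $\Omega\subset\mathbb R^2$ is fully symmetric if $(s,t)\in\Omega$ implies $(\pm s,\pm t)\in\Omega$; a weight $W$ on it is fully symmetric if $W(s,t)=W(\pm s,\pm t)$. A weight is nonnegative with positive integral and finite moments. Put $$\sqrt\Omega=\{(u,v):u\ge0,\ v\ge0,\ (\sqrt u,\sqrt v)\in\Omega\},\qquad W_{\pm\frac12,\pm\frac12}(u,v)=u^{\pm\frac12}v^{\pm\frac12}W(\sqrt u,\sqrt v),\quad (u,v)\in\sqrt\Omega,$$ where the two signs are independent. For a weight $U$ on a planar domain $D$, the inner product is $\int_D fg\,U$ and $\mathcal V_n(U,D)$ is the space of polynomials of total degree at most $n$ orthogonal to all polynomials of degree $<n$. $\mathcal V_n^E(W,\Omega)$ and $\mathcal V_n^O(W,\Omega)$ are the subspaces of $\mathcal V_n(W,\Omega)$ of polynomials that are even, respectively odd, in the first variable. *)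

theory Defs
  imports "HOL-Analysis.Analysis" "HOL-Library.Function_Algebras"
begin

text \<open>
  Polynomials in two real variables are identified with the functions they induce on the plane.
  HOL-Analysis has no vector space instance for function types, so we interpret the
  locale for pointwise scaling; this provides the library notions of subspace, span and
  independence for sets of functions, prefixed by \<open>fun_vs\<close>.
\<close>

definition scale_fun :: "real \<Rightarrow> (real \<times> real \<Rightarrow> real) \<Rightarrow> real \<times> real \<Rightarrow> real" where
  "scale_fun c f = (\<lambda>x. c * f x)"

global_interpretation fun_vs: vector_space scale_fun
  by unfold_locales (auto simp: scale_fun_def fun_eq_iff algebra_simps)

definition monomial2 :: "nat \<Rightarrow> nat \<Rightarrow> real \<times> real \<Rightarrow> real" where
  "monomial2 i j = (\<lambda>(x, y). x ^ i * y ^ j)"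

definition polys_upto :: "nat \<Rightarrow> (real \<times> real \<Rightarrow> real) set" where
  "polys_upto n = fun_vs.span {monomial2 i j | i j. i + j \<le> n}"


text \<open>The values of \<open>U\<close> outside \<open>D\<close> are irrelevant. The case \<open>i = j = 0\<close> of
  the moment condition also yields the measurability of \<open>U\<close> on \<open>D\<close>.\<close>

definition weight_on :: "(real \<times> real) set \<Rightarrow> (real \<times> real \<Rightarrow> real) \<Rightarrow> bool" where
  "weight_on D U \<longleftrightarrow>
     (\<forall>x\<in>D. 0 \<le> U x) \<and>
     (\<forall>i j. set_integrable lebesgue D (\<lambda>x. monomial2 i j x * U x)) \<and>
     0 < set_lebesgue_integral lebesgue D U"

definition weighted_inner ::
  "(real \<times> real \<Rightarrow> real) \<Rightarrow> (real \<times> real) set \<Rightarrow>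
   (real \<times> real \<Rightarrow> real) \<Rightarrow> (real \<times> real \<Rightarrow> real) \<Rightarrow> real" where
  "weighted_inner U D f g = set_lebesgue_integral lebesgue D (\<lambda>x. f x * g x * U x)"

definition orth_polys ::
  "nat \<Rightarrow> (real \<times> real \<Rightarrow> real) \<Rightarrow> (real \<times> real) set \<Rightarrow> (real \<times> real \<Rightarrow> real) set" where
  "orth_polys n U D =
     {p \<in> polys_upto n. \<forall>k<n. \<forall>q\<in>polys_upto k. weighted_inner U D p q = 0}"

definition orth_polys_even ::
  "nat \<Rightarrow> (real \<times> real \<Rightarrow> real) \<Rightarrow> (real \<times> real) set \<Rightarrow> (real \<times> real \<Rightarrow> real) set" where
  "orth_polys_even n U D = {p \<in> orth_polys n U D. \<forall>x y. p (- x, y) = p (x, y)}"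

definition orth_polys_odd ::
  "nat \<Rightarrow> (real \<times> real \<Rightarrow> real) \<Rightarrow> (real \<times> real) set \<Rightarrow> (real \<times> real \<Rightarrow> real) set" where
  "orth_polys_odd n U D = {p \<in> orth_polys n U D. \<forall>x y. p (- x, y) = - p (x, y)}"


text \<open>Injectivity of the indexing is stated because independence of the set \<open>e ` J\<close>
  does not exclude repetitions in the family.\<close>

definition orthonormal_basis ::
  "(real \<times> real \<Rightarrow> real) \<Rightarrow> (real \<times> real) set \<Rightarrow>
   'i set \<Rightarrow> ('i \<Rightarrow> real \<times> real \<Rightarrow> real) \<Rightarrow> (real \<times> real \<Rightarrow> real) set \<Rightarrow> bool" where
  "orthonormal_basis U D J e V \<longleftrightarrow>
     inj_on e J \<and> fun_vs.independent (e ` J) \<and> fun_vs.span (e ` J) = V \<and>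
     (\<forall>i\<in>J. \<forall>j\<in>J. weighted_inner U D (e i) (e j) = (if i = j then 1 else 0))"


definition fully_symmetric_set :: "(real \<times> real) set \<Rightarrow> bool" where
  "fully_symmetric_set D \<longleftrightarrow>
     (\<forall>s t. (s, t) \<in> D \<longrightarrow> (- s, t) \<in> D \<and> (s, - t) \<in> D \<and> (- s, - t) \<in> D)"

definition fully_symmetric_weight ::
  "(real \<times> real) set \<Rightarrow> (real \<times> real \<Rightarrow> real) \<Rightarrow> bool" where
  "fully_symmetric_weight D W \<longleftrightarrow>
     (\<forall>s t. (s, t) \<in> D \<longrightarrow>
        W (- s, t) = W (s, t) \<and> W (s, - t) = W (s, t) \<and> W (- s, - t) = W (s, t))"

definition sqrt_domain :: "(real \<times> real) set \<Rightarrow> (real \<times> real) set" where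
  "sqrt_domain D = {(u, v). 0 \<le> u \<and> 0 \<le> v \<and> (sqrt u, sqrt v) \<in> D}"

text \<open>To be used with \<open>a\<close> and \<open>b\<close> in \<open>{-1/2, 1/2}\<close>. On the coordinate axes, a null set,
  \<open>0 powr (-1/2) = 0\<close> replaces the undefined value.\<close>

definition sqrt_weight ::
  "real \<Rightarrow> real \<Rightarrow> (real \<times> real \<Rightarrow> real) \<Rightarrow> real \<times> real \<Rightarrow> real" where
  "sqrt_weight a b W = (\<lambda>(u, v). u powr a * v powr b * W (sqrt u, sqrt v))"


text \<open>In the following, \<open>P a b m j\<close> is the polynomial $P_{j,m}(W_{a,b})$.\<close>

definition even_family ::
  "(real \<Rightarrow> real \<Rightarrow> nat \<Rightarrow> nat \<Rightarrow> real \<times> real \<Rightarrow> real) \<Rightarrow>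
   nat \<Rightarrow> nat \<Rightarrow> real \<times> real \<Rightarrow> real" where
  "even_family P n j = (\<lambda>(u, v).
     if even n then P (-1/2) (-1/2) (n div 2) j (u\<^sup>2, v\<^sup>2)
     else v * P (-1/2) (1/2) (n div 2) j (u\<^sup>2, v\<^sup>2))"

text \<open>For \<open>n = 0\<close> the index set below is empty, so that the truncated \<open>n div 2 - 1\<close> in
  \<open>odd_family\<close> is then never used.\<close>

definition odd_family ::
  "(real \<Rightarrow> real \<Rightarrow> nat \<Rightarrow> nat \<Rightarrow> real \<times> real \<Rightarrow> real) \<Rightarrow>
   nat \<Rightarrow> nat \<Rightarrow> real \<times> real \<Rightarrow> real" where
  "odd_family P n j = (\<lambda>(u, v).
     if even n then u * v * P (1/2) (1/2) (n div 2 - 1) j (u\<^sup>2, v\<^sup>2)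
     else u * P (1/2) (-1/2) (n div 2) j (u\<^sup>2, v\<^sup>2))"

definition odd_index :: "nat \<Rightarrow> nat set" where
  "odd_index n = (if even n then {j. j < n div 2} else {j. j \<le> n div 2})"

end

theory Submission
  imports Defs
begin

text \<open>
  For \<open>a, b \<in> {0, 1}\<close>, the substitution \<open>(u, v) = (x\<^sup>2, y\<^sup>2)\<close> shows that
  \<open>r \<mapsto> x\<^sup>a y\<^sup>b r(x\<^sup>2, y\<^sup>2)\<close> is isometric from polynomials with the weight
  \<open>W\<^bsub>a-1/2,b-1/2\<^esub>\<close> on the square root domain to polynomials with the weight \<open>W\<close>; its image
  consists of the polynomials with parity \<open>(a, b)\<close> in the two variables. The four parity classes
  are mutually orthogonal by symmetry, so orthogonality to lower degrees can be tested within each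
  class, and the map takes \<open>V\<^sub>m\<close> into \<open>V\<^sub>n\<close> with \<open>n = 2m + a + b\<close>. Conversely, given
  \<open>p \<in> V\<^sub>n\<close> with parity \<open>a\<close> in the first variable, its component whose total parity differs
  from that of \<open>n\<close> has degree less than \<open>n\<close>, is orthogonal to its own class, and hence vanishes;
  the other component comes from \<open>V\<^sub>m\<close>.
\<close>

section \<open>Reflections and square roots of the coordinates in planar integrals\<close>

text \<open>Since \<open>sqrt\<close> is extended to negative arguments as an odd function, it is a
  bijection of the whole line, and its inverse \<open>x * |x|\<close> has derivative
  \<open>2 * |x|\<close>. Substituting this inverse on symmetric compact intervals and exhausting
  the line gives the density.\<close>

lemma distr_lborel_sqrt:
  "distr lborel lborel sqrt = density lborel (\<lambda>s::real. ennreal (2 * \<bar>s\<bar>))"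
proof (rule measure_eqI)
  fix A assume "A \<in> sets (distr lborel lborel sqrt)"
  then have A [measurable]: "A \<in> sets borel" by simp
  define f :: "real \<Rightarrow> ennreal" where "f x = indicator A (sqrt x)" for x
  define g :: "real \<Rightarrow> real" where "g x = x * \<bar>x\<bar>" for x
  have f [measurable]: "f \<in> borel_measurable borel"
    unfolding f_def by measurable
  have sqrt_g: "sqrt (g x) = x" for x
    by (cases "x \<ge> 0") (auto simp: g_def real_sqrt_minus)
  have deriv_g: "(g has_real_derivative 2 * \<bar>x\<bar>) (at x)" for x
  \<comment> \<open>At 0 the difference quotient of \<open>g\<close> is \<open>|h|\<close>; on each
    open half-line \<open>g\<close> is \<open>x * x\<close> up to sign.\<close>
  proof (cases "x = 0")
    case True
    have "((\<lambda>h::real. \<bar>h\<bar>) \<longlongrightarrow> 0) (at 0)"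
      by (rule tendsto_eq_intros refl | simp)+
    then have "((\<lambda>h. (g (0 + h) - g 0) / h) \<longlongrightarrow> 0) (at 0)"
      by (rule Lim_transform_eventually) (auto simp: g_def eventually_at_filter)
    then show ?thesis using True by (simp add: DERIV_def)
  next
    case False
    then consider "x > 0" | "x < 0" by linarith
    then show ?thesis
    proof cases
      case 1
      have "((\<lambda>x. x * x) has_real_derivative 2 * \<bar>x\<bar>) (at x)"
        using 1 by (auto intro!: derivative_eq_intros)
      then show ?thesis
        by (rule has_field_derivative_transform_within_open[of _ _ _ "{0<..}"])
          (use 1 in \<open>auto simp: g_def\<close>)
    next
      case 2
      have "((\<lambda>x. - (x * x)) has_real_derivative 2 * \<bar>x\<bar>) (at x)"
        using 2 by (auto intro!: derivative_eq_intros)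
      then show ?thesis
        by (rule has_field_derivative_transform_within_open[of _ _ _ "{..<0}"])
          (use 2 in \<open>auto simp: g_def\<close>)
    qed
  qed
  have step: "(\<integral>\<^sup>+x. f x * indicator {-(real n)\<^sup>2..(real n)\<^sup>2} x \<partial>lborel) =
      (\<integral>\<^sup>+x. ennreal (2 * \<bar>x\<bar>) * indicator A x * indicator {-real n..real n} x \<partial>lborel)" for n
  \<comment> \<open>The substitution is applied on nondegenerate intervals; for \<open>n = 0\<close>
    both sides integrate over a single point.\<close>
  proof (cases "n = 0")
    case True
    have "(\<integral>\<^sup>+x. h x * indicator {0::real} x \<partial>lborel) = 0" for h :: "real \<Rightarrow> ennreal"
      by (rule nn_integral_null_set) auto
    from this[of f] this[of "\<lambda>x. ennreal (2 * \<bar>x\<bar>) * indicator A x"] show ?thesis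
      using True by simp
  next
    case False
    have "(\<integral>\<^sup>+x. f x * indicator {g (- real n)..g (real n)} x \<partial>lborel) =
      (\<integral>\<^sup>+x. f (g x) * ennreal (2 * \<bar>x\<bar>) * indicator {-real n..real n} x \<partial>lborel)"
      by (rule nn_integral_substitution_aux)
        (use False deriv_g in \<open>auto intro!: continuous_intros\<close>)
    then show ?thesis
      by (simp add: sqrt_g f_def mult_ac) (simp add: g_def power2_eq_square)
  qed
  have sup: "h x = (SUP n. h x * indicator {- c n..c n} x)"
    if "filterlim c at_top sequentially" for h :: "real \<Rightarrow> ennreal" and c :: "nat \<Rightarrow> real" and x
  proof -
    have "\<forall>\<^sub>F n in sequentially. \<bar>x\<bar> \<le> c n"
      using that unfolding filterlim_at_top by blast
    then obtain n where n: "\<bar>x\<bar> \<le> c n"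
      by (auto simp: eventually_sequentially)
    show ?thesis
    proof (rule antisym)
      show "h x \<le> (SUP n. h x * indicator {- c n..c n} x)"
        by (rule SUP_upper2[of n]) (use n in \<open>auto simp: indicator_def\<close>)
      show "(SUP n. h x * indicator {- c n..c n} x) \<le> h x"
        by (rule SUP_least) (auto simp: indicator_def)
    qed
  qed
  have exhaust: "(\<integral>\<^sup>+x. h x \<partial>lborel) = (SUP n. \<integral>\<^sup>+x. h x * indicator {- c n..c n} x \<partial>lborel)"
    if [measurable]: "h \<in> borel_measurable borel" and "mono c" "filterlim c at_top sequentially"
    for h :: "real \<Rightarrow> ennreal" and c :: "nat \<Rightarrow> real"
  proof -
    have "(\<integral>\<^sup>+x. h x \<partial>lborel) = (\<integral>\<^sup>+x. (SUP n. h x * indicator {- c n..c n} x) \<partial>lborel)"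
      using sup[OF that(3)] by simp
    also have "\<dots> = (SUP n. \<integral>\<^sup>+x. h x * indicator {- c n..c n} x \<partial>lborel)"
    proof (rule nn_integral_monotone_convergence_SUP)
      show "incseq (\<lambda>n x. h x * indicator {- c n..c n} x)"
      proof (rule incseq_SucI, rule le_funI)
        fix n x
        have "c n \<le> c (Suc n)" using \<open>mono c\<close> by (simp add: mono_def)
        then show "h x * indicator {- c n..c n} x \<le> h x * indicator {- c (Suc n)..c (Suc n)} x"
          by (auto simp: indicator_def)
      qed
    qed measurable
    finally show ?thesis .
  qed
  have "emeasure (distr lborel lborel sqrt) A = (\<integral>\<^sup>+x. f x \<partial>lborel)"
  proof -
    have "f = indicator (sqrt -` A)"
      by (auto simp: f_def indicator_def)
    moreover have "sqrt -` A \<in> sets lborel"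
      using measurable_sets[of sqrt lborel lborel A] by simp
    ultimately show ?thesis by (simp add: emeasure_distr)
  qed
  also have "\<dots> = (SUP n. \<integral>\<^sup>+x. f x * indicator {-(real n)\<^sup>2..(real n)\<^sup>2} x \<partial>lborel)"
  proof (rule exhaust)
    show "mono (\<lambda>n. (real n)\<^sup>2)" by (intro monoI power_mono) auto
    show "filterlim (\<lambda>n. (real n)\<^sup>2) at_top sequentially"
      by (rule filterlim_pow_at_top[OF _ filterlim_real_sequentially]) simp
  qed measurable
  also have "\<dots> = (\<integral>\<^sup>+x. ennreal (2 * \<bar>x\<bar>) * indicator A x \<partial>lborel)"
    unfolding step
  proof (rule exhaust[symmetric])
    show "mono real" by (rule monoI) simp
  qed (measurable, rule filterlim_real_sequentially)
  also have "\<dots> = emeasure (density lborel (\<lambda>s. ennreal (2 * \<bar>s\<bar>))) A"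
    by (simp add: emeasure_density)
  finally show "emeasure (distr lborel lborel sqrt) A = \<dots>" .
qed simp

lemma sigma_finite_density_ennreal:
  assumes "sigma_finite_measure M" "f \<in> borel_measurable M"
  shows "sigma_finite_measure (density M (\<lambda>x. ennreal (f x)))"
  using sigma_finite_measure.sigma_finite_iff_density_finite[OF assms(1), of "\<lambda>x. ennreal (f x)"] assms
  by auto

abbreviation sqrt_pair :: "real \<times> real \<Rightarrow> real \<times> real" where
  "sqrt_pair \<equiv> \<lambda>(x, y). (sqrt x, sqrt y)"

lemma distr_lborel_sqrt_pair:
  "distr lborel lborel sqrt_pair = density lborel (\<lambda>(s, t). ennreal (4 * \<bar>s\<bar> * \<bar>t\<bar>))"
proof -
  let ?d = "\<lambda>s::real. ennreal (2 * \<bar>s\<bar>)"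
  have sf: "sigma_finite_measure (density lborel ?d)"
    by (rule sigma_finite_density_ennreal) (auto intro: sigma_finite_lborel)
  have "distr lborel lborel sqrt_pair
      = distr (lborel \<Otimes>\<^sub>M lborel) (lborel \<Otimes>\<^sub>M lborel) (\<lambda>(x, y). (sqrt x, sqrt y))"
    by (simp add: lborel_prod)
  also have "\<dots> = distr lborel lborel sqrt \<Otimes>\<^sub>M distr lborel lborel sqrt"
    by (rule pair_measure_distr[symmetric]) (auto simp: distr_lborel_sqrt sf)
  also have "\<dots> = density (lborel \<Otimes>\<^sub>M lborel) (\<lambda>(s, t). ?d s * ?d t)"
    unfolding distr_lborel_sqrt
    by (rule pair_measure_density) (auto simp: sf sigma_finite_lborel)
  also have "\<dots> = density lborel (\<lambda>(s, t). ennreal (4 * \<bar>s\<bar> * \<bar>t\<bar>))"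
    by (simp add: lborel_prod ennreal_mult[symmetric] mult_ac)
  finally show ?thesis .
qed

text \<open>The axes are hyperplanes, hence null. Consequently the density
  \<open>4 * |s| * |t|\<close> is positive almost everywhere, and the four open quadrants cover the
  plane up to a null set.\<close>

lemma AE_lborel_coordinates_nonzero: "AE (x :: real \<times> real) in lborel. fst x \<noteq> 0 \<and> snd x \<noteq> 0"
proof -
  have "(0, 1) \<in> (Basis :: (real \<times> real) set)" "(1, 0) \<in> (Basis :: (real \<times> real) set)"
    by (auto simp: Basis_prod_def)
  then have "negligible {x::real \<times> real. x \<bullet> (0, 1) = 0}" "negligible {x::real \<times> real. x \<bullet> (1, 0) = 0}"
    by blast+
  then have "{x::real \<times> real. snd x = 0} \<in> null_sets lebesgue" "{x::real \<times> real. fst x = 0} \<in> null_sets lebesgue"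
    by (simp_all add: negligible_iff_null_sets inner_prod_def)
  then have "AE x::real\<times>real in lebesgue. snd x \<noteq> 0" "AE x::real\<times>real in lebesgue. fst x \<noteq> 0"
    by (auto dest: AE_not_in)
  then show ?thesis unfolding AE_completion_iff by auto
qed

text \<open>The Borel version passes to the completion because the density is positive almost
  everywhere: the image measure then has the null sets of \<open>lborel\<close>, so completion
  commutes with both the image and the density.\<close>

lemma
  shows sqrt_pair_measurable_lebesgue: "sqrt_pair \<in> lebesgue \<rightarrow>\<^sub>M lebesgue"
    and distr_lebesgue_sqrt_pair:
      "distr lebesgue lebesgue sqrt_pair = density lebesgue (\<lambda>(s, t). ennreal (4 * \<bar>s\<bar> * \<bar>t\<bar>))"
proof -
  let ?d = "\<lambda>(s::real, t::real). ennreal (4 * \<bar>s\<bar> * \<bar>t\<bar>)"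
  have d: "?d \<in> borel_measurable lborel"
    by (simp add: borel_prod[symmetric] split_beta')
  have pos: "AE x in lborel. 0 < ?d x"
    using AE_lborel_coordinates_nonzero by eventually_elim auto
  have ms: "sqrt_pair \<in> lborel \<rightarrow>\<^sub>M lborel"
    by (simp add: borel_prod[symmetric] split_beta')
  then have m: "sqrt_pair \<in> lebesgue \<rightarrow>\<^sub>M lborel"
    by (rule measurable_completion)
  have eq: "distr lebesgue lborel sqrt_pair = density lborel ?d"
    using distr_lborel_sqrt_pair by (simp add: distr_completion[OF ms])
  have null: "null_sets (distr lebesgue lborel sqrt_pair) = null_sets lborel"
  proof -
    have "emeasure lborel A = 0 \<longleftrightarrow> A \<in> null_sets (density lborel ?d)" if A: "A \<in> sets lborel" for A
    proof -
      have "A \<in> null_sets (density lborel ?d) \<longleftrightarrow> (AE x in lborel. x \<in> A \<longrightarrow> ?d x = 0)"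
        using A by (simp add: null_sets_density_iff[OF d])
      also have "\<dots> \<longleftrightarrow> (AE x in lborel. x \<notin> A)"
        using pos by (intro eventually_cong) auto
      also have "\<dots> \<longleftrightarrow> emeasure lborel A = 0"
        using A AE_iff_null_sets null_setsD1 null_setsI by metis
      finally show ?thesis ..
    qed
    then show ?thesis unfolding eq by (auto simp: null_sets_def)
  qed

  show "sqrt_pair \<in> lebesgue \<rightarrow>\<^sub>M lebesgue"
    by (rule completion.measurable_completion2[OF m]) (simp add: null)
  have "distr lebesgue lebesgue sqrt_pair = completion (density lborel ?d)"
    using completion.completion_distr_eq[OF m null] by (simp add: eq)
  also have "\<dots> = density lebesgue ?d"
    by (rule completion_density_eq[OF pos d])
  finally show "distr lebesgue lebesgue sqrt_pair = density lebesgue ?d" .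
qed

lemma integral_lebesgue_sqrt_pair:
  fixes H :: "real \<times> real \<Rightarrow> real"
  assumes "H \<in> borel_measurable lebesgue"
  shows "(\<integral>x. H (sqrt_pair x) \<partial>lebesgue) = (\<integral>x. 4 * \<bar>fst x\<bar> * \<bar>snd x\<bar> * H x \<partial>lebesgue)"
proof -
  have m: "(\<lambda>x::real \<times> real. 4 * \<bar>fst x\<bar> * \<bar>snd x\<bar>) \<in> borel_measurable lebesgue"
    by (intro measurable_completion) (simp add: borel_prod[symmetric])
  have "(\<integral>x. H (sqrt_pair x) \<partial>lebesgue) = integral\<^sup>L (distr lebesgue lebesgue sqrt_pair) H"
    by (simp add: integral_distr sqrt_pair_measurable_lebesgue assms)
  also have "\<dots> = integral\<^sup>L (density lebesgue (\<lambda>x. ennreal (4 * \<bar>fst x\<bar> * \<bar>snd x\<bar>))) H"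
    using distr_lebesgue_sqrt_pair by (simp add: split_beta')
  also have "\<dots> = (\<integral>x. 4 * \<bar>fst x\<bar> * \<bar>snd x\<bar> * H x \<partial>lebesgue)"
    by (subst integral_density[OF assms m]) auto
  finally show ?thesis .
qed

section \<open>Reflections in the coordinate axes and reduction to a quadrant\<close>

lemma
  assumes "c \<in> {-1, 1}" "d \<in> {-1, 1}"
  shows measurable_lebesgue_reflect_prod: "(\<lambda>(x::real, y::real). (c * x, d * y)) \<in> lebesgue \<rightarrow>\<^sub>M lebesgue"
    and distr_lebesgue_reflect_prod:
      "distr lebesgue lebesgue (\<lambda>(x::real, y::real). (c * x, d * y)) = lebesgue"
proof -
  \<comment> \<open>The reflection is the diagonal affine map with entries \<open>e\<close>, of
    determinant 1 in absolute value.\<close>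
  define e :: "real \<times> real \<Rightarrow> real" where "e j = (if j = (1, 0) then c else d)" for j
  have B: "(Basis :: (real \<times> real) set) = {(1, 0), (0, 1)}"
    by (auto simp: Basis_prod_def)
  have T: "(\<lambda>x. 0 + (\<Sum>j\<in>Basis. (e j * (x \<bullet> j)) *\<^sub>R j)) = (\<lambda>(x, y). (c * x, d * y))"
    by (auto simp: B e_def inner_prod_def)
  have ne: "\<And>j. j \<in> Basis \<Longrightarrow> e j \<noteq> 0"
    using assms by (auto simp: e_def)
  show "(\<lambda>(x::real, y::real). (c * x, d * y)) \<in> lebesgue \<rightarrow>\<^sub>M lebesgue"
    using lebesgue_affine_measurable[where c = e and t = 0, OF ne] unfolding T .
  have "(\<Prod>j\<in>Basis. \<bar>e j\<bar>) = 1"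
    using assms by (auto simp: B e_def)
  then show "distr lebesgue lebesgue (\<lambda>(x::real, y::real). (c * x, d * y)) = lebesgue"
    using lebesgue_affine_euclidean[where c = e and t = 0, OF ne] unfolding T by (simp add: density_1)
qed

text \<open>For measurable \<open>f\<close> this is invariance of the measure. Otherwise both sides
  take the default value 0: the reflection is an involution, so composing with it cannot make
  \<open>f\<close> measurable.\<close>

lemma integral_lebesgue_reflect_prod:
  fixes f :: "real \<times> real \<Rightarrow> real"
  assumes cd: "c \<in> {-1, 1}" "d \<in> {-1, 1}"
  shows "(\<integral>x. f (c * fst x, d * snd x) \<partial>lebesgue) = (\<integral>x. f x \<partial>lebesgue)"
proof -
  let ?T = "\<lambda>(x::real, y::real). (c * x, d * y)"
  have inv: "?T (?T x) = x" for x
    using cd by (cases x) auto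
  note T = measurable_lebesgue_reflect_prod[OF cd] distr_lebesgue_reflect_prod[OF cd]
  have eq: "(\<lambda>x. f (c * fst x, d * snd x)) = (\<lambda>x. f (?T x))"
    by (simp add: split_beta')
  show ?thesis
  proof (cases "f \<in> borel_measurable lebesgue")
    case True
    then show ?thesis
      using integral_distr[OF T(1) True] unfolding T(2) eq by simp
  next
    case False
    have "(\<lambda>x. f (?T x)) \<notin> borel_measurable lebesgue"
    proof
      assume "(\<lambda>x. f (?T x)) \<in> borel_measurable lebesgue"
      from measurable_compose[OF T(1) this] show False
        using False by (simp only: inv)
    qed
    with False show ?thesis unfolding eq
      by (metis borel_measurable_integrable not_integrable_integral_eq)
  qed
qed

text \<open>Off the axes \<open>f\<close> is the sum of its restrictions to the four open quadrants,
  and reflections carry each of these to the restriction to the positive one.\<close>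

lemma integral_lebesgue_quadrant:
  fixes f :: "real \<times> real \<Rightarrow> real"
  assumes f: "integrable lebesgue f"
    and sym: "\<And>x y. f (- x, y) = f (x, y)" "\<And>x y. f (x, - y) = f (x, y)"
  shows "(\<integral>x. f x \<partial>lebesgue) = 4 * (\<integral>x. indicator ({0<..} \<times> {0<..}) x * f x \<partial>lebesgue)"
proof -
  let ?Q = "{0<..} \<times> {0<..} :: (real \<times> real) set"
  \<comment> \<open>By symmetry of \<open>f\<close> this is its restriction to the quadrant with
    signs \<open>c\<close> and \<open>d\<close>, written as a reflection of
    \<open>g 1 1\<close>.\<close>
  define g where "g c d x = indicator ?Q (c * fst x, d * snd x) * f (c * fst x, d * snd x)"
    for c d :: real and x :: "real \<times> real"
  have g_refl: "g c d = (\<lambda>x. g 1 1 (c * fst x, d * snd x))" for c d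
    by (auto simp: g_def fun_eq_iff)
  have ints: "integrable lebesgue (g c d)" if cd: "c \<in> {-1, 1}" "d \<in> {-1, 1}" for c d
  proof -
    have "g c d x = indicator {x. 0 < c * fst x \<and> 0 < d * snd x} x *\<^sub>R f x" for x
      using cd by (cases x) (auto simp: g_def sym indicator_def)
    moreover have "{x :: real \<times> real. 0 < c * fst x \<and> 0 < d * snd x} \<in> sets lebesgue"
      by (auto intro!: borel_open open_Collect_conj open_Collect_less continuous_intros)
    ultimately show ?thesis
      using integrable_mult_indicator[OF _ f] by presburger
  qed
  have int_eq: "(\<integral>x. g c d x \<partial>lebesgue) = (\<integral>x. g 1 1 x \<partial>lebesgue)"
    if "c \<in> {-1, 1}" "d \<in> {-1, 1}" for c d
    unfolding g_refl[of c d] by (rule integral_lebesgue_reflect_prod[OF that])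
  have "AE x in lebesgue. f x = g 1 1 x + g 1 (-1) x + g (-1) 1 x + g (-1) (-1) x"
    using AE_completion[OF AE_lborel_coordinates_nonzero]
  proof eventually_elim
    case (elim x)
    then show ?case
      by (cases x) (auto simp: g_def sym indicator_def)
  qed
  then have "(\<integral>x. f x \<partial>lebesgue) = (\<integral>x. g 1 1 x + g 1 (-1) x + g (-1) 1 x + g (-1) (-1) x \<partial>lebesgue)"
    by (rule integral_cong_AE[rotated 2])
      (simp_all add: borel_measurable_integrable f ints Bochner_Integration.integrable_add)
  also have "\<dots> = 4 * (\<integral>x. g 1 1 x \<partial>lebesgue)"
    by (simp add: ints int_eq[of 1 "-1"] int_eq[of "-1" 1] int_eq[of "-1" "-1"])
  finally show ?thesis by (simp add: g_def)
qed

section \<open>Parity classes of polynomials\<close>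

text \<open>Resolution with an induction rule eta-expands a function-typed induction variable; with
  these simplification rules active, terms such as \<open>\<lambda>x. (f + g) x\<close> would then be unfolded.\<close>

declare plus_fun_apply [simp del] times_fun_apply [simp del] zero_fun_apply [simp del]

lemmas fun_apply = plus_fun_apply times_fun_apply zero_fun_apply scale_fun_def

definition polys :: "(real \<times> real \<Rightarrow> real) set" where
  "polys = fun_vs.span (range (\<lambda>(i, j). monomial2 i j))"

lemma monomial2_in_polys [simp]: "monomial2 i j \<in> polys"
  unfolding polys_def by (rule fun_vs.span_base) (auto intro!: image_eqI[of _ _ "(i, j)"])

lemma polys_upto_subset_polys: "polys_upto n \<subseteq> polys"
  unfolding polys_upto_def polys_def by (rule fun_vs.span_mono) auto

lemma polys_upto_mono: "m \<le> n \<Longrightarrow> polys_upto m \<subseteq> polys_upto n"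
  unfolding polys_upto_def by (rule fun_vs.span_mono) (use order_trans in blast)

lemma polys_induct [consumes 1, case_names zero add]:
  assumes "p \<in> polys" "Q 0" "\<And>c i j p. Q p \<Longrightarrow> Q (scale_fun c (monomial2 i j) + p)"
  shows "Q p"
  using assms(1) unfolding polys_def
  by (induction rule: fun_vs.span_induct_alt) (use assms in auto)

lemma polys_add: "p \<in> polys \<Longrightarrow> q \<in> polys \<Longrightarrow> p + q \<in> polys"
  and polys_zero: "0 \<in> polys"
  and polys_scale: "p \<in> polys \<Longrightarrow> scale_fun c p \<in> polys"
  unfolding polys_def by (rule fun_vs.span_add fun_vs.span_zero fun_vs.span_scale; assumption)+

lemma polys_mult:
  assumes "p \<in> polys" "q \<in> polys"
  shows "p * q \<in> polys"
  using assms(1)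
proof (induction rule: polys_induct)
  case (add c i j p)
  have "monomial2 i j * q \<in> polys"
    using assms(2)
  proof (induction rule: polys_induct)
    case (add c' i' j' q)
    have "monomial2 i j * (scale_fun c' (monomial2 i' j') + q)
        = scale_fun c' (monomial2 (i + i') (j + j')) + monomial2 i j * q"
      by (auto simp: fun_eq_iff fun_apply monomial2_def algebra_simps power_add)
    then show ?case using add by (simp add: polys_add polys_scale)
  qed (simp add: polys_zero)
  moreover have "(scale_fun c (monomial2 i j) + p) * q = scale_fun c (monomial2 i j * q) + p * q"
    by (auto simp: fun_eq_iff fun_apply algebra_simps)
  ultimately show ?case using add by (simp add: polys_add polys_scale)
qed (simp add: polys_zero)

lemma polys_continuous: "p \<in> polys \<Longrightarrow> continuous_on UNIV p"
proof (induction rule: polys_induct)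
  case (add c i j p)
  have "continuous_on UNIV (\<lambda>x. c * (fst x ^ i * snd x ^ j) + p x)"
    using add by (intro continuous_intros)
  then show ?case
    by (simp add: scale_fun_def monomial2_def plus_fun_def split_beta')
qed (simp add: zero_fun_def)

definition lift :: "nat \<Rightarrow> nat \<Rightarrow> (real \<times> real \<Rightarrow> real) \<Rightarrow> real \<times> real \<Rightarrow> real" where
  "lift a b r = (\<lambda>(x, y). x ^ a * y ^ b * r (x\<^sup>2, y\<^sup>2))"

lemma lift_add: "lift a b (r + s) = lift a b r + lift a b s"
  and lift_scale: "lift a b (scale_fun c r) = scale_fun c (lift a b r)"
  and lift_zero: "lift a b 0 = 0"
  and lift_monomial2: "lift a b (monomial2 i j) = monomial2 (2 * i + a) (2 * j + b)"
  by (auto simp: lift_def fun_eq_iff fun_apply monomial2_def algebra_simps power_add power_mult[symmetric])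

interpretation lift: module_hom scale_fun scale_fun "lift a b"
  by (intro module_hom.intro module_hom_axioms.intro fun_vs.module_axioms lift_add lift_scale)

text \<open>The degree is measured after lifting: \<open>lift a b\<close> sends
  \<open>monomial2 i j\<close> to a monomial of degree \<open>2 * (i + j) + a + b\<close>. Written
  without subtraction, the condition stays correct for \<open>k < a + b\<close>.\<close>

definition half_polys :: "nat \<Rightarrow> nat \<Rightarrow> nat \<Rightarrow> (real \<times> real \<Rightarrow> real) set" where
  "half_polys a b k = fun_vs.span {monomial2 i j | i j. 2 * (i + j) + a + b \<le> k}"

text \<open>All lifted monomials of one class have degrees of the same parity, so passing from
  \<open>2 * m + a + b\<close> to the next degree admits nothing new. This slack of one later makes
  the component of wrong parity vanish.\<close>

lemma half_polys_eq_polys_upto: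
  assumes "2 * m + a + b \<le> k" "k \<le> 2 * m + a + b + 1"
  shows "half_polys a b k = polys_upto m"
proof -
  have "2 * (i + j) + a + b \<le> k \<longleftrightarrow> i + j \<le> m" for i j
    using assms by auto
  then show ?thesis by (simp add: half_polys_def polys_upto_def)
qed

lemma half_polys_trivial:
  assumes "k < a + b"
  shows "half_polys a b k = {0}"
proof -
  have "{monomial2 i j | i j. 2 * (i + j) + a + b \<le> k} = {}"
    using assms by auto
  then show ?thesis by (simp only: half_polys_def fun_vs.span_empty)
qed

lemma half_polys_subset_polys: "half_polys a b k \<subseteq> polys"
  unfolding half_polys_def polys_def by (rule fun_vs.span_mono) auto

lemma lift_half_polys: "lift a b ` half_polys a b k \<subseteq> polys_upto k"
  unfolding half_polys_def polys_upto_def lift.span_image[symmetric]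
proof (rule fun_vs.span_mono, clarify)
  fix i j assume "2 * (i + j) + a + b \<le> k"
  then show "\<exists>i' j'. lift a b (monomial2 i j) = monomial2 i' j' \<and> i' + j' \<le> k"
    by (intro exI[of _ "2 * i + a"] exI[of _ "2 * j + b"]) (simp add: lift_monomial2)
qed

lemma lift_polys_upto: "r \<in> polys_upto m \<Longrightarrow> lift a b r \<in> polys_upto (2 * m + a + b)"
  using lift_half_polys[of a b "2 * m + a + b"] half_polys_eq_polys_upto[of m a b "2 * m + a + b"]
  by auto

lemma lift_polys:
  assumes "r \<in> polys" shows "lift a b r \<in> polys"
proof -
  have "lift a b ` polys \<subseteq> polys"
    unfolding polys_def lift.span_image[symmetric]
    by (rule fun_vs.span_mono) (force simp: lift_monomial2)
  with assms show ?thesis by auto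
qed

text \<open>A monomial with exponents \<open>i\<close> and \<open>j\<close> is the lift of the one
  with \<open>i div 2\<close> and \<open>j div 2\<close>, in the class given by
  \<open>i mod 2\<close> and \<open>j mod 2\<close>; linearity does the rest.\<close>

lemma parity_decomposition:
  assumes "p \<in> polys_upto k"
  shows "\<exists>r. (\<forall>a b. r a b \<in> half_polys a b k) \<and>
    p = lift 0 0 (r 0 0) + lift 0 1 (r 0 1) + lift 1 0 (r 1 0) + lift 1 1 (r 1 1)"
  using assms unfolding polys_upto_def
proof (induction rule: fun_vs.span_induct_alt)
  case base
  show ?case
    by (rule exI[of _ "\<lambda>_ _. 0"])
      (simp add: lift_zero half_polys_def fun_vs.span_zero)
next
  case (step c f g)
  then obtain r where r: "\<forall>a b. r a b \<in> half_polys a b k"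
    "g = lift 0 0 (r 0 0) + lift 0 1 (r 0 1) + lift 1 0 (r 1 0) + lift 1 1 (r 1 1)"
    by blast
  from step obtain i j where f: "f = monomial2 i j" and ij: "i + j \<le> k" by blast
  define m where "m = monomial2 (i div 2) (j div 2)"
  have "2 * (i div 2 + j div 2) + i mod 2 + j mod 2
      = (2 * (i div 2) + i mod 2) + (2 * (j div 2) + j mod 2)"
    by (simp only: distrib_left add_ac)
  then have "2 * (i div 2 + j div 2) + i mod 2 + j mod 2 \<le> k"
    using ij by (simp only: mult_div_mod_eq)
  then have m: "m \<in> half_polys (i mod 2) (j mod 2) k"
    unfolding half_polys_def m_def by (blast intro: fun_vs.span_base)
  have f': "f = lift (i mod 2) (j mod 2) m"
    by (simp add: m_def lift_monomial2 f)
  define r' where "r' a b = (if a = i mod 2 \<and> b = j mod 2 then scale_fun c m + r a b else r a b)" for a b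
  have "\<forall>a b. r' a b \<in> half_polys a b k"
    using r(1) m by (auto simp: r'_def half_polys_def intro!: fun_vs.span_add fun_vs.span_scale)
  moreover have "scale_fun c f + g
      = lift 0 0 (r' 0 0) + lift 0 1 (r' 0 1) + lift 1 0 (r' 1 0) + lift 1 1 (r' 1 1)"
    unfolding r(2) f' r'_def
    by (cases "even i"; cases "even j")
      (simp_all add: lift_add lift_scale even_iff_mod_2_eq_zero odd_iff_mod_2_eq_one add_ac)
  ultimately show ?case by blast
qed

text \<open>Comparing the values at \<open>(- x, y)\<close> and \<open>(x, y)\<close> shows that the
  two components of the other parity in \<open>x\<close> sum to 0.\<close>

lemma parity_decomposition_fst:
  assumes p: "p \<in> polys_upto k" and c: "c \<le> 1"
    and sym: "\<And>x y. p (- x, y) = (- 1) ^ c * p (x, y)"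
  obtains r s where "r \<in> half_polys c 0 k" "s \<in> half_polys c 1 k" "p = lift c 0 r + lift c 1 s"
proof -
  obtain r where r: "\<forall>a b. r a b \<in> half_polys a b k"
    "p = lift 0 0 (r 0 0) + lift 0 1 (r 0 1) + lift 1 0 (r 1 0) + lift 1 1 (r 1 1)"
    using parity_decomposition[OF p] by blast
  have "p z = (lift c 0 (r c 0) + lift c 1 (r c 1)) z" for z
  proof (cases z)
    case (Pair x y)
    from c consider "c = 0" | "c = 1" by linarith
    then show ?thesis
      using sym[of x y] unfolding r(2) Pair
      by cases (simp_all add: lift_def fun_apply)
  qed
  then show thesis
    using r(1) by (intro that[of "r c 0" "r c 1"]) (simp_all add: fun_eq_iff)
qed

lemma orthonormal_basis_mem:
  assumes "orthonormal_basis U D J e V" "j \<in> J"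
  shows "e j \<in> V"
  using assms unfolding orthonormal_basis_def by (metis fun_vs.span_base imageI)

section \<open>Orthogonality for a fully symmetric weight\<close>

locale symmetric_weight =
  fixes \<Omega> :: "(real \<times> real) set" and W :: "real \<times> real \<Rightarrow> real"
  assumes meas: "\<Omega> \<in> sets lebesgue"
    and sym_set: "fully_symmetric_set \<Omega>"
    and weight: "weight_on \<Omega> W"
    and sym_weight: "fully_symmetric_weight \<Omega> W"
begin

abbreviation ip where "ip \<equiv> weighted_inner W \<Omega>"

text \<open>For \<open>a\<close> in {0, 1} the exponent \<open>real a - 1/2\<close> is -1/2 or 1/2,
  so the same index names the weight and the power of \<open>x\<close> in
  \<open>lift\<close>.\<close>

abbreviation sip where
  "sip a b \<equiv> weighted_inner (sqrt_weight (real a - 1/2) (real b - 1/2) W) (sqrt_domain \<Omega>)"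

abbreviation sorth where
  "sorth a b m \<equiv> orth_polys m (sqrt_weight (real a - 1/2) (real b - 1/2) W) (sqrt_domain \<Omega>)"

text \<open>Extension of the weight by zero, which makes every inner product an integral over the
  whole plane.\<close>

definition G :: "real \<times> real \<Rightarrow> real" where
  "G x = indicator \<Omega> x * W x"

lemma sym_set_iff: "(- x, y) \<in> \<Omega> \<longleftrightarrow> (x, y) \<in> \<Omega>" "(x, - y) \<in> \<Omega> \<longleftrightarrow> (x, y) \<in> \<Omega>"
  using sym_set unfolding fully_symmetric_set_def by (metis minus_minus)+

lemma G_reflect: "G (- x, y) = G (x, y)" "G (x, - y) = G (x, y)"
  using sym_weight unfolding fully_symmetric_weight_def G_def
  by (auto simp: indicator_def sym_set_iff)

lemma ip_eq: "ip f g = (\<integral>x. f x * g x * G x \<partial>lebesgue)"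
  unfolding weighted_inner_def set_lebesgue_integral_def G_def by (simp add: mult_ac)

lemma integrable_poly_G: "p \<in> polys \<Longrightarrow> integrable lebesgue (\<lambda>x. p x * G x)"
proof (induction rule: polys_induct)
  case (add c i j p)
  have "integrable lebesgue (\<lambda>x. monomial2 i j x * G x)"
    using weight unfolding weight_on_def set_integrable_def G_def by (simp add: mult_ac)
  then have "integrable lebesgue (\<lambda>x. c * (monomial2 i j x * G x) + p x * G x)"
    using add by simp
  then show ?case by (simp add: fun_apply algebra_simps)
qed (simp add: fun_apply)

lemma G_measurable: "G \<in> borel_measurable lebesgue"
  using borel_measurable_integrable[OF integrable_poly_G[OF monomial2_in_polys[of 0 0]]]
  by (simp add: monomial2_def split_beta')

lemma integrable_ip:
  assumes "p \<in> polys" "q \<in> polys"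
  shows "integrable lebesgue (\<lambda>x. p x * q x * G x)"
  using integrable_poly_G[OF polys_mult[OF assms]] by (simp add: fun_apply)

lemma ip_commute: "ip f g = ip g f"
  by (simp add: ip_eq mult_ac)

lemma ip_add:
  assumes "p \<in> polys" "q \<in> polys" "q' \<in> polys"
  shows "ip p (q + q') = ip p q + ip p q'"
  using integrable_ip assms by (simp add: ip_eq fun_apply algebra_simps)

lemma ip_scale: "ip p (scale_fun c q) = c * ip p q"
  by (simp add: ip_eq scale_fun_def mult_ac)

lemma ip_zero: "ip p 0 = 0"
  by (simp add: ip_eq fun_apply)

text \<open>Membership in \<open>polys\<close> is carried through the induction because additivity
  of \<open>ip\<close> rests on integrability.\<close>

lemma ip_sum:
  assumes "p \<in> polys" "finite I" "\<And>i. i \<in> I \<Longrightarrow> q i \<in> polys"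
  shows "ip p (\<Sum>i\<in>I. scale_fun (u i) (q i)) = (\<Sum>i\<in>I. u i * ip p (q i)) \<and>
     (\<Sum>i\<in>I. scale_fun (u i) (q i)) \<in> polys"
  using assms(2,3)
  by (induction) (use assms(1) in \<open>auto simp: ip_zero polys_zero ip_add polys_scale polys_add ip_scale\<close>)

lemma ip_zero_span:
  assumes "p \<in> polys" "S \<subseteq> polys" "\<And>q. q \<in> S \<Longrightarrow> ip p q = 0" "q \<in> fun_vs.span S"
  shows "ip p q = 0"
proof -
  have "q \<in> polys \<and> ip p q = 0"
    using assms(4)
    by (induction rule: fun_vs.span_induct_alt)
      (use assms(1-3) in \<open>auto simp: polys_zero ip_zero ip_add polys_scale polys_add ip_scale\<close>)
  then show ?thesis ..
qed

text \<open>\<open>G\<close> is invariant under the reflection, so the integral equals its own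
  negative.\<close>

lemma ip_eq_zero_of_odd:
  assumes "c \<in> {-1, 1}" "d \<in> {-1, 1}"
    and odd: "\<And>x y. f (c * x, d * y) * g (c * x, d * y) = - (f (x, y) * g (x, y))"
  shows "ip f g = 0"
proof -
  have "(\<integral>x. f x * g x * G x \<partial>lebesgue)
      = (\<integral>x. f (c * fst x, d * snd x) * g (c * fst x, d * snd x) * G (c * fst x, d * snd x) \<partial>lebesgue)"
    using integral_lebesgue_reflect_prod[OF assms(1,2), of "\<lambda>x. f x * g x * G x"] by simp
  also have "\<dots> = (\<integral>x. - (f x * g x * G x) \<partial>lebesgue)"
    using assms(1,2) G_reflect by (intro Bochner_Integration.integral_cong) (auto simp: odd)
  also have "\<dots> = - (\<integral>x. f x * g x * G x \<partial>lebesgue)"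
    by simp
  finally show ?thesis by (simp add: ip_eq)
qed

lemma ip_lift_distinct_parity:
  assumes "odd (a + a') \<or> odd (b + b')"
  shows "ip (lift a b r) (lift a' b' s) = 0"
  using assms
proof
  assume "odd (a + a')"
  then show ?thesis
    by (intro ip_eq_zero_of_odd[of "-1" 1]) (auto simp: lift_def)
next
  assume "odd (b + b')"
  then show ?thesis
    by (intro ip_eq_zero_of_odd[of 1 "-1"]) (auto simp: lift_def)
qed

text \<open>Substituting squares for the coordinates turns \<open>u powr (a - 1/2)\<close> into
  \<open>x powr (2 * a - 1)\<close>; the density contributes one more factor \<open>x\<close>, which
  gives the two factors \<open>x ^ a\<close> of the lifts, and likewise for \<open>y\<close>. The
  remaining factor 4 is the number of quadrants.\<close>

lemma ip_lift:
  assumes r: "r \<in> polys" and s: "s \<in> polys"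
  shows "ip (lift a b r) (lift a b s) = sip a b r s"
proof -
  let ?Q = "{0<..} \<times> {0<..} :: (real \<times> real) set"
  define h where "h x = lift a b r x * lift a b s x * G x" for x
  \<comment> \<open>Chosen so that composition with \<open>sqrt_pair\<close> yields the integrand of
    \<open>sip a b r s\<close>.\<close>
  define H where "H = (\<lambda>(x, y). indicator ?Q (x, y) * x powr (2 * real a - 1) * y powr (2 * real b - 1)
     * r (x\<^sup>2, y\<^sup>2) * s (x\<^sup>2, y\<^sup>2) * G (x, y))"
  have cont: "continuous_on UNIV (\<lambda>x. q ((fst x)\<^sup>2, (snd x)\<^sup>2))" if "q \<in> polys" for q :: "real \<times> real \<Rightarrow> real"
    by (rule continuous_on_compose2[OF polys_continuous[OF that]]) (auto intro!: continuous_intros)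
  have H_meas: "H \<in> borel_measurable lebesgue"
  proof -
    have 1: "(\<lambda>x. indicator ?Q x * fst x powr (2 * real a - 1) * snd x powr (2 * real b - 1) ::real) \<in> borel_measurable borel"
      by (simp add: borel_prod[symmetric])
    have "(\<lambda>x. r ((fst x)\<^sup>2, (snd x)\<^sup>2)) \<in> borel_measurable borel" "(\<lambda>x. s ((fst x)\<^sup>2, (snd x)\<^sup>2)) \<in> borel_measurable borel"
      using cont[OF r] cont[OF s] by (auto intro: borel_measurable_continuous_onI)
    with 1 have "(\<lambda>x. indicator ?Q x * fst x powr (2 * real a - 1) * snd x powr (2 * real b - 1)
         * r ((fst x)\<^sup>2, (snd x)\<^sup>2) * s ((fst x)\<^sup>2, (snd x)\<^sup>2)) \<in> borel_measurable lebesgue"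
      by (intro measurable_completion) auto
    from borel_measurable_times[OF this G_measurable] show ?thesis
      by (simp add: H_def split_beta')
  qed
  have "sip a b r s = (\<integral>x. H (sqrt_pair x) \<partial>lebesgue)"
    unfolding weighted_inner_def set_lebesgue_integral_def
  proof (rule Bochner_Integration.integral_cong)
    fix x :: "real \<times> real"
    obtain u v where x: "x = (u, v)" by fastforce
    have "sqrt u powr (2 * real a - 1) = u powr (real a - 1/2)" "sqrt v powr (2 * real b - 1) = v powr (real b - 1/2)"
      if "0 < u" "0 < v"
      using that by (simp_all add: powr_half_sqrt[symmetric] powr_powr algebra_simps)
    \<comment> \<open>The equality is pointwise even on the axes: there the weight is 0 because
      \<open>0 powr z = 0\<close>, and \<open>H\<close> is 0 by its indicator.\<close>
    then show "indicator (sqrt_domain \<Omega>) x *\<^sub>R (r x * s x * sqrt_weight (real a - 1/2) (real b - 1/2) W x) = H (sqrt_pair x)"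
      by (cases "u = 0"; cases "v = 0")
        (auto simp: x H_def sqrt_domain_def sqrt_weight_def G_def indicator_def)
  qed simp
  also have "\<dots> = (\<integral>x. 4 * \<bar>fst x\<bar> * \<bar>snd x\<bar> * H x \<partial>lebesgue)"
    by (rule integral_lebesgue_sqrt_pair[OF H_meas])
  also have "\<dots> = (\<integral>x. 4 * (indicator ?Q x * h x) \<partial>lebesgue)"
  proof (rule Bochner_Integration.integral_cong)
    fix x :: "real \<times> real"
    obtain u v where x: "x = (u, v)" by fastforce
    have *: "t * t powr (2 * real n - 1) = t ^ n * t ^ n" if "0 < t" for t :: real and n
      using that by (simp add: powr_diff powr_realpow[symmetric] powr_add[symmetric])
    show "4 * \<bar>fst x\<bar> * \<bar>snd x\<bar> * H x = 4 * (indicator ?Q x * h x)"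
    proof (cases "x \<in> ?Q")
      case True
      then have "4 * \<bar>fst x\<bar> * \<bar>snd x\<bar> * H x
        = 4 * (u * u powr (2 * real a - 1)) * (v * v powr (2 * real b - 1)) * r (u\<^sup>2, v\<^sup>2) * s (u\<^sup>2, v\<^sup>2) * G x"
        by (simp add: x H_def mult_ac)
      also have "\<dots> = 4 * (u ^ a * u ^ a) * (v ^ b * v ^ b) * r (u\<^sup>2, v\<^sup>2) * s (u\<^sup>2, v\<^sup>2) * G x"
        using True by (subst (1 2) *) (simp_all add: x)
      also have "\<dots> = 4 * (indicator ?Q x * h x)"
        using True by (simp add: x h_def lift_def mult_ac)
      finally show ?thesis .
    qed (auto simp: H_def x)
  qed simp
  also have "\<dots> = 4 * (\<integral>x. indicator ?Q x * h x \<partial>lebesgue)"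
    by simp
  also have "\<dots> = (\<integral>x. h x \<partial>lebesgue)"
  proof (rule integral_lebesgue_quadrant[symmetric])
    show "integrable lebesgue h"
      unfolding h_def using integrable_ip lift_polys r s by blast
    have [simp]: "(-x) ^ n * ((-x) ^ n * y) = x ^ n * (x ^ n * y)" for x y :: real and n
      by (simp add: mult.assoc[symmetric] power_mult_distrib[symmetric])
    show "h (- x, y) = h (x, y)" "h (x, - y) = h (x, y)" for x y
      by (simp_all add: h_def lift_def G_reflect mult_ac)
  qed
  finally show ?thesis by (simp add: ip_eq h_def)
qed

text \<open>Of the four parity components of a test polynomial, three drop out by reflection. The
  one in the class of \<open>r\<close> is the lift of a polynomial of degree below \<open>m\<close>,
  to which \<open>r\<close> is orthogonal.\<close>

lemma lift_in_orth_polys: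
  assumes r: "r \<in> sorth a b m" and ab: "a \<le> 1" "b \<le> 1"
  shows "lift a b r \<in> orth_polys (2 * m + a + b) W \<Omega>"
proof -
  have rm: "r \<in> polys_upto m" and orth: "\<And>k s. k < m \<Longrightarrow> s \<in> polys_upto k \<Longrightarrow> sip a b r s = 0"
    using r unfolding orth_polys_def by auto
  have rp: "r \<in> polys" using rm polys_upto_subset_polys by blast
  have lp: "\<And>a' b' s k. s \<in> half_polys a' b' k \<Longrightarrow> lift a' b' s \<in> polys"
    using half_polys_subset_polys lift_polys by blast
  have "ip (lift a b r) q = 0" if k: "k < 2 * m + a + b" and q: "q \<in> polys_upto k" for k q
  proof -
    obtain t where t: "\<forall>a b. t a b \<in> half_polys a b k"
      "q = lift 0 0 (t 0 0) + lift 0 1 (t 0 1) + lift 1 0 (t 1 0) + lift 1 1 (t 1 1)"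
      using parity_decomposition[OF q] by blast
    have same: "ip (lift a b r) (lift a b (t a b)) = 0"
    proof (cases "k < a + b")
      case True
      then have "t a b = 0" using t(1) half_polys_trivial by blast
      then show ?thesis by (simp add: lift_zero ip_zero)
    next
      case False
      \<comment> \<open>The largest degree whose lift has degree at most \<open>k\<close>; the bound
        on \<open>k\<close> forces \<open>l < m\<close>.\<close>
      define l where "l = (k - a - b) div 2"
      have "half_polys a b k = polys_upto l"
        by (rule half_polys_eq_polys_upto) (use False in \<open>auto simp: l_def\<close>)
      then have tl: "t a b \<in> polys_upto l" using t(1) by blast
      have "l < m" using k False by (auto simp: l_def)
      then show ?thesis
        using orth[OF _ tl] tl rp polys_upto_subset_polys by (subst ip_lift) auto
    qed
    have "ip (lift a b r) (lift a' b' (t a' b')) = 0" if "a' \<le> 1" "b' \<le> 1" for a' b'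
    proof (cases "a' = a \<and> b' = b")
      case False
      then have "odd (a + a') \<or> odd (b + b')" using that ab by presburger
      then show ?thesis by (rule ip_lift_distinct_parity)
    qed (use same in auto)
    moreover have "lift a' b' (t a' b') \<in> polys" for a' b'
      using lp t(1) by blast
    ultimately show ?thesis
      unfolding t(2) using lift_polys[OF rp] by (simp add: ip_add polys_add)
  qed
  then show ?thesis
    using lift_polys_upto[OF rm] unfolding orth_polys_def by blast
qed

text \<open>The isometry transports the inner products. Injectivity of the indexing and independence
  are then read off from orthonormality of the lifted family.\<close>

lemma orthonormal_basis_lift:
  assumes basis: "orthonormal_basis (sqrt_weight (real a - 1/2) (real b - 1/2) W) (sqrt_domain \<Omega>) J e V"
    and V: "V \<subseteq> polys"
  shows "orthonormal_basis W \<Omega> J (\<lambda>j. lift a b (e j)) (lift a b ` V)"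
proof -
  have e: "\<And>j. j \<in> J \<Longrightarrow> e j \<in> polys"
    using orthonormal_basis_mem[OF basis] V by blast
  have on: "ip (lift a b (e i)) (lift a b (e j)) = (if i = j then 1 else 0)" if "i \<in> J" "j \<in> J" for i j
    using basis that unfolding orthonormal_basis_def by (simp add: ip_lift e)
  have inj: "inj_on (\<lambda>j. lift a b (e j)) J"
    by (rule inj_onI) (metis on zero_neq_one)
  have "fun_vs.independent ((\<lambda>j. lift a b (e j)) ` J)"
  proof
    assume "fun_vs.dependent ((\<lambda>j. lift a b (e j)) ` J)"
    then obtain i where i: "i \<in> J"
      and span: "lift a b (e i) \<in> fun_vs.span ((\<lambda>j. lift a b (e j)) ` J - {lift a b (e i)})"
      unfolding fun_vs.dependent_def by auto
    have "ip (lift a b (e i)) (lift a b (e i)) = 0"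
      by (rule ip_zero_span[OF _ _ _ span]) (use i e on lift_polys in auto)
    with on[OF i i] show False by simp
  qed
  moreover have "fun_vs.span ((\<lambda>j. lift a b (e j)) ` J) = lift a b ` V"
    using basis lift.span_image[of a b "e ` J"] unfolding orthonormal_basis_def by (simp add: image_image)
  ultimately show ?thesis
    unfolding orthonormal_basis_def using inj on by blast
qed

text \<open>The coefficients of an expansion along an orthonormal basis are inner products. This is
  the form of definiteness on which the vanishing of components rests.\<close>

lemma orthonormal_basis_expansion_zero:
  assumes basis: "orthonormal_basis W \<Omega> J e V" and "finite J" "V \<subseteq> polys" "p \<in> V"
    and orth: "\<And>j. j \<in> J \<Longrightarrow> ip p (e j) = 0"
  shows "p = 0"
proof -
  have e: "\<And>j. j \<in> J \<Longrightarrow> e j \<in> polys"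
    using orthonormal_basis_mem[OF basis] assms(3) by blast
  have on: "ip (e i) (e j) = (if i = j then 1 else 0)" if "i \<in> J" "j \<in> J" for i j
    using basis that unfolding orthonormal_basis_def by blast
  have "p \<in> fun_vs.span (e ` J)"
    using basis assms(4) unfolding orthonormal_basis_def by blast
  then obtain u where u: "p = (\<Sum>v\<in>e ` J. scale_fun (u v) v)"
    unfolding fun_vs.span_finite[OF finite_imageI[OF \<open>finite J\<close>]] by blast
  have "inj_on e J"
    using basis unfolding orthonormal_basis_def by blast
  then have p: "p = (\<Sum>j\<in>J. scale_fun (u (e j)) (e j))"
    unfolding u by (simp add: sum.reindex)
  have "u (e j) = 0" if j: "j \<in> J" for j
  proof -
    have "ip (e j) p = (\<Sum>i\<in>J. u (e i) * ip (e j) (e i))"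
      unfolding p using ip_sum[OF e[OF j] \<open>finite J\<close>, of e "\<lambda>i. u (e i)"] e by blast
    also have "\<dots> = u (e j)"
      using j \<open>finite J\<close> by (simp add: on if_distrib[of "\<lambda>x. _ * x"] cong: if_cong)
    finally show ?thesis using orth[OF j] by (simp add: ip_commute)
  qed
  then show "p = 0" unfolding p by (simp add: scale_fun_def zero_fun_def[symmetric])
qed

text \<open>The sign treats the even subspace (\<open>c = 0\<close>) and the odd one
  (\<open>c = 1\<close>) at once.\<close>

definition orth_parity :: "nat \<Rightarrow> nat \<Rightarrow> (real \<times> real \<Rightarrow> real) set" where
  "orth_parity c n = {p \<in> orth_polys n W \<Omega>. \<forall>x y. p (- x, y) = (- 1) ^ c * p (x, y)}"

end

section \<open>Descent from orthogonal polynomials of \<open>W\<close> to those of the four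
  transformed weights\<close>

locale symmetric_weight_basis = symmetric_weight +
  fixes P :: "nat \<Rightarrow> nat \<Rightarrow> nat \<Rightarrow> nat \<Rightarrow> real \<times> real \<Rightarrow> real"
  assumes basis: "\<And>a b m. a \<le> 1 \<Longrightarrow> b \<le> 1 \<Longrightarrow>
    orthonormal_basis (sqrt_weight (real a - 1/2) (real b - 1/2) W) (sqrt_domain \<Omega>) {0..m}
      (P a b m) (sorth a b m)"
begin

text \<open>A polynomial of degree at most \<open>m\<close> orthogonal to all such polynomials lies in
  the orthogonal space of degree \<open>m + 1\<close>, and is there orthogonal to every basis element.\<close>

lemma lift_eq_zero:
  assumes ab: "a \<le> 1" "b \<le> 1" and r: "r \<in> polys_upto m"
    and orth: "\<And>s. s \<in> polys_upto m \<Longrightarrow> ip (lift a b r) (lift a b s) = 0"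
  shows "lift a b r = 0"
proof -
  let ?V = "sorth a b (Suc m)"
  have V: "?V \<subseteq> polys"
    using polys_upto_subset_polys unfolding orth_polys_def by blast
  note B = basis[OF ab, of "Suc m"]
  have rp: "r \<in> polys" using r polys_upto_subset_polys by blast
  have "sip a b r s = 0" if "k < Suc m" "s \<in> polys_upto k" for k s
  proof -
    have s: "s \<in> polys_upto m" using that polys_upto_mono[of k m] by auto
    then have "s \<in> polys" using polys_upto_subset_polys by blast
    from ip_lift[OF rp this, of a b] show ?thesis using orth[OF s] by simp
  qed
  then have rV: "r \<in> ?V"
    using r polys_upto_mono[of m "Suc m"] unfolding orth_polys_def by auto
  show ?thesis
  proof (rule orthonormal_basis_expansion_zero[OF orthonormal_basis_lift[OF B V]])
    show "lift a b ` ?V \<subseteq> polys" using V lift_polys by blast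
    show "lift a b r \<in> lift a b ` ?V" using rV by blast
    fix j assume "j \<in> {0..Suc m}"
    then have e: "P a b (Suc m) j \<in> ?V" using orthonormal_basis_mem[OF B] by blast
    \<comment> \<open>The orthogonality used here is that of the basis element to degree
      \<open>m\<close>, which contains \<open>r\<close>.\<close>
    have "sip a b (P a b (Suc m) j) r = 0"
      using e r unfolding orth_polys_def by blast
    moreover have "P a b (Suc m) j \<in> polys" using e V by blast
    ultimately show "ip (lift a b r) (lift a b (P a b (Suc m) j)) = 0"
      using ip_lift[OF _ rp, of "P a b (Suc m) j" a b] by (simp add: ip_commute)
  qed simp
qed

text \<open>Testing \<open>p\<close> against a lift in one class isolates the component in that
  class, since the other is orthogonal by parity in \<open>y\<close>; the degree bounds make the
  test polynomial admissible.\<close>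

lemma orth_polys_component:
  assumes p: "p \<in> orth_polys n W \<Omega>" and eq: "p = lift c 0 r + lift c 1 s"
    and r: "r \<in> polys" and s: "s \<in> polys" and t: "t \<in> polys_upto l"
  shows "2 * l + c < n \<Longrightarrow> ip (lift c 0 r) (lift c 0 t) = 0"
    and "2 * l + c + 1 < n \<Longrightarrow> ip (lift c 1 s) (lift c 1 t) = 0"
proof -
  have tp: "t \<in> polys" using t polys_upto_subset_polys by blast
  have lin: "ip p (lift c b t) = ip (lift c 0 r) (lift c b t) + ip (lift c 1 s) (lift c b t)" for b
    unfolding eq using r s tp lift_polys
    by (subst (1 2 3) ip_commute) (simp add: ip_add)
  have orth: "ip p (lift c b t) = 0" if "2 * l + c + b < n" for b
    using p that lift_polys_upto[OF t, of c b] unfolding orth_polys_def by blast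
  show "ip (lift c 0 r) (lift c 0 t) = 0" if "2 * l + c < n"
    using lin[of 0] orth[of 0] that ip_lift_distinct_parity[of c c 1 0 s t] by simp
  show "ip (lift c 1 s) (lift c 1 t) = 0" if "2 * l + c + 1 < n"
    using lin[of 1] orth[of 1] that ip_lift_distinct_parity[of c c 0 1 r t] by simp
qed

lemma orth_parity_eq_lift_or_zero:
  assumes c: "c \<le> 1" and p: "p \<in> orth_parity c n"
  obtains "p = 0" "n < c"
    | d m r where "d \<le> 1" "n = 2 * m + c + d" "r \<in> sorth c d m" "p = lift c d r"
proof -
  have po: "p \<in> orth_polys n W \<Omega>" and pn: "p \<in> polys_upto n"
    and sym: "\<And>x y. p (- x, y) = (- 1) ^ c * p (x, y)"
    using p unfolding orth_parity_def orth_polys_def by auto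
  obtain r s where rs: "r \<in> half_polys c 0 n" "s \<in> half_polys c 1 n" "p = lift c 0 r + lift c 1 s"
    using parity_decomposition_fst[OF pn c sym] by blast
  define q where "q d = (if d = 0 then r else s)" for d :: nat
  have q: "q d \<in> half_polys c d n" if "d \<le> 1" for d
    using rs that by (cases "d = 0") (auto simp: q_def le_Suc_eq)
  have qp: "q d \<in> polys" if "d \<le> 1" for d
    using q[OF that] half_polys_subset_polys by blast
  have pq: "p = lift c 0 (q 0) + lift c 1 (q 1)"
    using rs(3) by (simp add: q_def)
  have orth: "ip (lift c d (q d)) (lift c d t) = 0"
    if "d \<le> 1" "2 * l + c + d < n" "t \<in> polys_upto l" for d l t
    using orth_polys_component[OF po pq qp qp that(3)] that by (cases "d = 0") (auto simp: le_Suc_eq)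
  have vanish: "lift c d (q d) = 0" if d: "d \<le> 1" and "n < c + d \<or> odd (n + c + d)" for d
  proof (cases "n < c + d")
    case True
    then have "q d = 0" using half_polys_trivial q[OF d] by blast
    then show ?thesis by (simp add: lift_zero)
  next
    case False
    with that have "odd (n + c + d)" by blast
    then have "odd (n - c - d)" using False by presburger
    then obtain l where "n - c - d = 2 * l + 1" by (rule oddE)
    \<comment> \<open>With the wrong parity the component reaches degree at most
      \<open>n - 1\<close>, so every lift of an element of \<open>polys_upto l\<close> is an
      admissible test, including its own.\<close>
    then have l: "n = 2 * l + c + d + 1" using False by linarith
    have "q d \<in> polys_upto l"
      using q[OF d] half_polys_eq_polys_upto[of l c d n] l by simp
    then show ?thesis
      by (rule lift_eq_zero[OF c d]) (use orth[OF d, of l] l in auto)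
  qed
  show thesis
  proof (cases "n < c")
    case True
    then show ?thesis using that(1) vanish[of 0] vanish[of 1] pq by simp
  next
    case False
    \<comment> \<open>The parity in \<open>y\<close> for which \<open>c + d\<close> has the parity
      of \<open>n\<close>; the class \<open>1 - d\<close> vanishes.\<close>
    define d where "d = (n + c) mod 2"
    define m where "m = (n - c) div 2"
    have d: "d \<le> 1" and n: "n = 2 * m + c + d"
      using False unfolding d_def m_def by presburger+
    have "q d \<in> polys_upto m"
      using q[OF d] half_polys_eq_polys_upto[of m c d n] n by simp
    moreover have "sip c d (q d) t = 0" if "k < m" "t \<in> polys_upto k" for k t
      using orth[OF d _ that(2)] that ip_lift[OF qp[OF d], of t c d] polys_upto_subset_polys n by auto
    ultimately have "q d \<in> sorth c d m"
      unfolding orth_polys_def by blast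
    moreover have "p = lift c d (q d)"
      using pq vanish[of "1 - d"] d n by (cases "d = 0") (auto simp: le_Suc_eq)
    ultimately show ?thesis using that(2) d n by blast
  qed
qed

text \<open>Given \<open>c\<close>, the parity of \<open>n\<close> determines \<open>d\<close> and
  then \<open>m\<close>, so only one lifted class fills the space and its lifted basis
  suffices.\<close>

lemma orthonormal_basis_orth_parity:
  assumes cd: "c \<le> 1" "d \<le> 1" and n: "n = 2 * m + c + d"
  shows "orthonormal_basis W \<Omega> {0..m} (\<lambda>j. lift c d (P c d m j)) (orth_parity c n)"
proof -
  have "orth_parity c n = lift c d ` sorth c d m"
  proof (intro equalityI subsetI)
    fix p assume "p \<in> orth_parity c n"
    then show "p \<in> lift c d ` sorth c d m"
    proof (rule orth_parity_eq_lift_or_zero[OF cd(1)])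
      fix d' m' r assume *: "d' \<le> 1" "n = 2 * m' + c + d'" "r \<in> sorth c d' m'" "p = lift c d' r"
      then have eq: "2 * m' + d' = 2 * m + d" using n by linarith
      have "d' = d" using arg_cong[OF eq, of "\<lambda>k. k mod 2"] *(1) cd(2) by simp
      with eq have "m' = m" by simp
      with * \<open>d' = d\<close> show ?thesis by blast
    qed (use n in auto)
  next
    fix p assume "p \<in> lift c d ` sorth c d m"
    then obtain r where r: "r \<in> sorth c d m" "p = lift c d r" by blast
    moreover have "lift c d r (- x, y) = (- 1) ^ c * lift c d r (x, y)" for x y
      unfolding lift_def by (simp add: power_minus[of x c])
    ultimately show "p \<in> orth_parity c n"
      using lift_in_orth_polys[OF r(1) cd] n unfolding orth_parity_def by blast
  qed
  moreover have "sorth c d m \<subseteq> polys"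
    using polys_upto_subset_polys unfolding orth_polys_def by blast
  ultimately show ?thesis
    using orthonormal_basis_lift[OF basis[OF cd]] by simp
qed

text \<open>The odd half for \<open>n = 0\<close>, where the basis is empty:
  \<open>0 = 2 * m + 1 + d\<close> is impossible, which leaves only the zero alternative.\<close>

lemma orth_parity_trivial: "orth_parity 1 0 = {0}"
proof -
  have "0 \<in> orth_parity 1 0"
    by (auto simp: orth_parity_def orth_polys_def polys_upto_def fun_vs.span_zero zero_fun_apply)
  moreover have "p = 0" if "p \<in> orth_parity 1 0" for p
    using orth_parity_eq_lift_or_zero[OF _ that] by auto
  ultimately show ?thesis by blast
qed

end

section \<open>Identification of the two families with lifted bases\<close>

theorem theorem4p2:
  fixes \<Omega> :: "(real \<times> real) set"
    and W :: "real \<times> real \<Rightarrow> real"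
    and P :: "real \<Rightarrow> real \<Rightarrow> nat \<Rightarrow> nat \<Rightarrow> real \<times> real \<Rightarrow> real"
  assumes "\<Omega> \<in> sets lebesgue"
    and "fully_symmetric_set \<Omega>"
    and "weight_on \<Omega> W"
    and "fully_symmetric_weight \<Omega> W"
    and "\<And>a b m. \<lbrakk>a \<in> {-1/2, 1/2}; b \<in> {-1/2, 1/2}\<rbrakk> \<Longrightarrow>
           orthonormal_basis (sqrt_weight a b W) (sqrt_domain \<Omega>) {0..m} (P a b m)
             (orth_polys m (sqrt_weight a b W) (sqrt_domain \<Omega>))"
  shows "\<forall>n.
           orthonormal_basis W \<Omega> {0..n div 2} (even_family P n) (orth_polys_even n W \<Omega>) \<and>
           orthonormal_basis W \<Omega> (odd_index n) (odd_family P n) (orth_polys_odd n W \<Omega>)"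
proof (intro allI conjI)
  fix n
  \<comment> \<open>Reindexes the bases from the exponents -1/2 and 1/2 to the parities 0 and
    1.\<close>
  define Q where "Q a b = P (real a - 1/2) (real b - 1/2)" for a b
  have half: "real a - 1/2 \<in> {-1/2, 1/2}" if "a \<le> 1" for a
    using that by (cases "a = 0") (auto simp: le_Suc_eq)
  interpret symmetric_weight_basis \<Omega> W Q
    by unfold_locales (use assms half in \<open>auto simp only: Q_def\<close>)
  have par: "orth_polys_even n W \<Omega> = orth_parity 0 n" "orth_polys_odd n W \<Omega> = orth_parity 1 n"
    by (auto simp: orth_polys_even_def orth_polys_odd_def orth_parity_def)
  define d where "d = n mod 2"
  have d: "d \<le> 1" "n = 2 * (n div 2) + d" by (auto simp: d_def)
  have "even_family P n = (\<lambda>j. lift 0 d (Q 0 d (n div 2) j))"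
    by (cases "even n")
      (auto simp: even_family_def lift_def Q_def d_def fun_eq_iff odd_iff_mod_2_eq_one)
  then show "orthonormal_basis W \<Omega> {0..n div 2} (even_family P n) (orth_polys_even n W \<Omega>)"
    unfolding par using orthonormal_basis_orth_parity[of 0 d n "n div 2"] d by simp
  show "orthonormal_basis W \<Omega> (odd_index n) (odd_family P n) (orth_polys_odd n W \<Omega>)"
  proof (cases "n = 0")
    case True
    then show ?thesis
      unfolding par using orth_parity_trivial
      by (simp add: orthonormal_basis_def odd_index_def fun_vs.independent_empty)
  next
    case False
    \<comment> \<open>The factor \<open>u\<close> uses up one degree, so the parity in
      \<open>v\<close> is that of \<open>n - 1\<close>, namely \<open>1 - d\<close>. For even
      \<open>n\<close> this gives \<open>m = n div 2 - 1\<close>, a genuine subtraction since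
      \<open>n\<close> is positive.\<close>
    define m where "m = (n - 1) div 2"
    have n: "n = 2 * m + 1 + (1 - d)" using False unfolding m_def d_def by presburger
    have "odd_index n = {0..m}"
      using False by (auto simp: odd_index_def m_def elim!: evenE oddE)
    moreover have "even n \<Longrightarrow> n div 2 - 1 = m" "odd n \<Longrightarrow> n div 2 = m"
      using False unfolding m_def by presburger+
    then have "odd_family P n = (\<lambda>j. lift 1 (1 - d) (Q 1 (1 - d) m j))"
      by (cases "even n")
        (auto simp: odd_family_def lift_def Q_def d_def fun_eq_iff odd_iff_mod_2_eq_one)
    ultimately show ?thesis
      unfolding par using orthonormal_basis_orth_parity[of 1 "1 - d" n m] n by simp
  qed
qed

end
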